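(* Let $G=(S,E)$ be a finite connected undirected graph with $n=|S|$ states, with real numbers $V_i$ ($i\in S$) and $V_{ij}=V_{ji}$ ($(i,j)\in E$) satisfying the genericness assumption: all the values $V_i$, $i\in S$, and $V_{ij}$, $(i,j)\in E$, are distinct, and all the differences $V_{ij}-V_k$, $(i,j)\in E$, $k\in S$, are distinct. Let $\mathcal{T}^{\ast}$ be the (unique) minimum spanning tree of $G$ with respect to the edge costs $c_{ij}=V_{ij}$. Let $2\le k\le n$. For $j=1,\ldots,k$ let $g_j^{\ast}$ be the optimal $W$-graph with $j$ sinks, and let $\mathcal{T}_j^{\ast}$ be its underlying undirected forest. Let $s_k^{\ast}$ be the sink of $g_k^{\ast}$ that is not a sink of any $g_j^{\ast}$, $j=1,2,\ldots,k-1$, let $(p_{k-1}^{\ast},q_{k-1}^{\ast})$ be the edge of $\mathcal{T}_{k-1}^{\ast}$ that is not an edge of $\mathcal{T}_k^{\ast}$, and let $t_k$ be the subtree (connected component) of $\mathcal{T}_k^{\ast}$ containing $s_k^{\ast}$. Then the largest Freidlin's cycle $C_k$ containing $s_k^{\ast}$ and not containing any state $s$ with $V_s<V_{s_k^{\ast}}$ is the subset of states of $t_k$ given by $$C_k=\Bigl\{s\in t_k\ \Big|\ \max_{(i,j)\in w^{\ast}(s_k^{\ast},s)}V_{ij}<V_{p_{k-1}^{\ast}q_{k-1}^{\ast}}\Bigr\},$$ where $w^{\ast}(a,b)$ denotes the unique path in $\mathcal{T}^{\ast}$ connecting states $a$ and $b$.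
   Context: $W$-graphs: let $W\subseteq S$; the states in $W$ are called sinks. A $W$-graph is a directed graph on the set of states $S$, each of whose arrows $i\to j$ goes along an edge $(i,j)\in E$, such that (i) each state in $S\setminus W$ is the origin of exactly one arrow, and states in $W$ are the origin of no arrow; (ii) there are no cycles (equivalently to (ii), from every state in $S\setminus W$ there is a sequence of arrows leading to some sink in $W$). Forgetting arrow directions turns a $W$-graph with $|W|=k$ into a forest on $S$ with exactly $k$ trees (connected components), each containing exactly one sink. $G(k)$ denotes the set of all $W$-graphs over all subsets $W$ with exactly $k$ elements. An element $g_k^{\ast}\in G(k)$ minimizing $\sum_{(i\to j)\in g}(V_{ij}-V_i)$ over $g\in G(k)$ is called an optimal $W$-graph with $k$ sinks; its set of sinks is denoted $W_k^{\ast}$ and its undirected forest is denoted $\mathcal{T}_k^{\ast}$. Under the genericness assumption the optimal $W$-graphs are nested, $W_{j}^{\ast}\subset W_{j+1}^{\ast}$ and (as edge sets) $\mathcal{T}_{j+1}^{\ast}\subset\mathcal{T}_j^{\ast}$ for $1\le j\le n-1$, so passing from $g_{k-1}^{\ast}$ to $g_k^{\ast}$ adds exactly one sink, $s_k^{\ast}$, and removes exactly one edge, $(p_{k-1}^{\ast},q_{k-1}^{\ast})$. A minimum spanning tree is a spanning tree with minimal total sum of edge costs; under the genericness assumption it is unique. Freidlin's cycles: a Freidlin's cycle containing a state $s^{\ast}\in S$ is a subset of $S$ of the form $$C=\Bigl\{s\in S\ \Big|\ \max_{(i,j)\in w^{\ast}(s^{\ast},s)}V_{ij}<a\Bigr\},$$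 where $a$ is a real constant; the maximum over the empty path ($s=s^{\ast}$) is taken to be $-\infty$, so that $s^{\ast}\in C$. "Largest" is with respect to inclusion. *)

theory Defs
  imports "HOL-Library.Extended_Real"
begin

text \<open>
  Undirected graphs on a set of states \<open>S\<close> are given by their set of edges, an edge being an
  unordered pair \<open>{i, j}\<close> of distinct states. The numbers attached to the edges are given by a
  function \<open>U\<close> on unordered pairs, \<open>U {i, j}\<close> standing for \<open>V\<^sub>i\<^sub>j = V\<^sub>j\<^sub>i\<close>. The trees and forests of
  Graph_Theory are not used: there, a graph is a symmetric digraph, in which every edge
  already forms a directed cycle.
\<close>

definition simple_graph :: "'a set \<Rightarrow> 'a set set \<Rightarrow> bool" where
  "simple_graph S E \<longleftrightarrow> (\<forall>e\<in>E. \<exists>i\<in>S. \<exists>j\<in>S. i \<noteq> j \<and> e = {i, j})"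

definition adj :: "'a set set \<Rightarrow> 'a rel" where
  "adj F = {(i, j). {i, j} \<in> F}"

definition connected_graph :: "'a set \<Rightarrow> 'a set set \<Rightarrow> bool" where
  "connected_graph S F \<longleftrightarrow> S \<noteq> {} \<and> (\<forall>i\<in>S. \<forall>j\<in>S. (i, j) \<in> (adj F)\<^sup>*)"

definition component :: "'a set \<Rightarrow> 'a set set \<Rightarrow> 'a \<Rightarrow> 'a set" where
  "component S F i = {j \<in> S. (i, j) \<in> (adj F)\<^sup>*}"

definition path :: "'a set set \<Rightarrow> 'a \<Rightarrow> 'a list \<Rightarrow> 'a \<Rightarrow> bool" where
  "path F a p b \<longleftrightarrow>
     p \<noteq> [] \<and> hd p = a \<and> last p = b \<and> distinct p \<and> successively (\<lambda>i j. {i, j} \<in> F) p"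

definition path_edges :: "'a list \<Rightarrow> 'a set set" where
  "path_edges p = (\<lambda>(i, j). {i, j}) ` set (zip p (tl p))"

definition cycle :: "'a set set \<Rightarrow> 'a list \<Rightarrow> bool" where
  "cycle F p \<longleftrightarrow>
     3 \<le> length p \<and> distinct p \<and> successively (\<lambda>i j. {i, j} \<in> F) p \<and> {last p, hd p} \<in> F"

definition spanning_tree :: "'a set \<Rightarrow> 'a set set \<Rightarrow> 'a set set \<Rightarrow> bool" where
  "spanning_tree S E T \<longleftrightarrow> T \<subseteq> E \<and> connected_graph S T \<and> (\<nexists>p. cycle T p)"

definition min_spanning_tree ::
    "'a set \<Rightarrow> 'a set set \<Rightarrow> ('a set \<Rightarrow> real) \<Rightarrow> 'a set set \<Rightarrow> bool" where
  "min_spanning_tree S E c T \<longleftrightarrow>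
     spanning_tree S E T \<and> (\<forall>T'. spanning_tree S E T' \<longrightarrow> (\<Sum>e\<in>T. c e) \<le> (\<Sum>e\<in>T'. c e))"

text \<open>The path \<open>w\<^sup>*(a, b)\<close>, as its list of states; it is well defined when \<open>T\<close> is a spanning tree.\<close>

definition tree_path :: "'a set set \<Rightarrow> 'a \<Rightarrow> 'a \<Rightarrow> 'a list" where
  "tree_path T a b = (THE p. path T a p b)"

definition generic :: "'a set \<Rightarrow> 'a set set \<Rightarrow> ('a \<Rightarrow> real) \<Rightarrow> ('a set \<Rightarrow> real) \<Rightarrow> bool" where
  "generic S E V U \<longleftrightarrow>
     inj_on V S \<and> inj_on U E \<and> V ` S \<inter> U ` E = {} \<and>
     inj_on (\<lambda>(e, k). U e - V k) (E \<times> S)"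

definition W_graph :: "'a set \<Rightarrow> 'a set set \<Rightarrow> 'a set \<Rightarrow> 'a rel \<Rightarrow> bool" where
  "W_graph S E W g \<longleftrightarrow>
     (\<forall>(i, j)\<in>g. {i, j} \<in> E) \<and>
     (\<forall>i\<in>S - W. \<exists>!j. (i, j) \<in> g) \<and>
     (\<forall>i\<in>W. \<nexists>j. (i, j) \<in> g) \<and>
     acyclic g"

definition W_graphs :: "'a set \<Rightarrow> 'a set set \<Rightarrow> nat \<Rightarrow> 'a rel set" where
  "W_graphs S E k = {g. \<exists>W\<subseteq>S. card W = k \<and> W_graph S E W g}"

definition sinks :: "'a set \<Rightarrow> 'a rel \<Rightarrow> 'a set" where
  "sinks S g = {i \<in> S. \<nexists>j. (i, j) \<in> g}"

definition W_cost :: "('a \<Rightarrow> real) \<Rightarrow> ('a set \<Rightarrow> real) \<Rightarrow> 'a rel \<Rightarrow> real" where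
  "W_cost V U g = (\<Sum>(i, j)\<in>g. U {i, j} - V i)"

definition optimal_W_graph ::
    "'a set \<Rightarrow> 'a set set \<Rightarrow> ('a \<Rightarrow> real) \<Rightarrow> ('a set \<Rightarrow> real) \<Rightarrow> nat \<Rightarrow> 'a rel \<Rightarrow> bool" where
  "optimal_W_graph S E V U k g \<longleftrightarrow>
     g \<in> W_graphs S E k \<and> (\<forall>h\<in>W_graphs S E k. W_cost V U g \<le> W_cost V U h)"

definition undirected :: "'a rel \<Rightarrow> 'a set set" where
  "undirected g = (\<lambda>(i, j). {i, j}) ` g"

text \<open>The largest value along \<open>w\<^sup>*(a, b)\<close>, with value \<open>-\<infinity>\<close> on the empty path \<open>a = b\<close>.\<close>

definition path_max :: "'a set set \<Rightarrow> ('a set \<Rightarrow> real) \<Rightarrow> 'a \<Rightarrow> 'a \<Rightarrow> ereal" where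
  "path_max T U a b = Max (insert (-\<infinity>) ((\<lambda>e. ereal (U e)) ` path_edges (tree_path T a b)))"

definition freidlin_cycle ::
    "'a set \<Rightarrow> 'a set set \<Rightarrow> ('a set \<Rightarrow> real) \<Rightarrow> 'a \<Rightarrow> 'a set \<Rightarrow> bool" where
  "freidlin_cycle S T U s0 C \<longleftrightarrow> (\<exists>a::real. C = {s \<in> S. path_max T U s0 s < ereal a})"

definition is_largest :: "'a set set \<Rightarrow> 'a set \<Rightarrow> bool" where
  "is_largest A C \<longleftrightarrow> C \<in> A \<and> (\<forall>D\<in>A. D \<subseteq> C)"

end

theory Submission
  imports Defs
begin

text \<open>
  Add a root, joined to every state \<open>w\<close> by an edge of weight \<open>V\<^sub>w\<close>. A W-graph with \<open>k\<close> sinks is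
  then a spanning tree of the enlarged graph with exactly \<open>k\<close> root edges, namely those to its
  sinks: the arrows are recovered by directing every edge towards the root. Up to the constant
  \<open>\<Sum>\<^sub>i V\<^sub>i\<close>, the cost of the W-graph is the weight of the tree (\<open>W_graph_tree\<close>,
  \<open>red_tree_W_graph\<close>). Thus the optimal W-graphs are minimum spanning trees of the enlarged
  graph under the constraint that \<open>k\<close> edges are red, where the red edges are the root edges.

  By symmetric exchange, two edges of equal colour that are exchanged between two optimal trees
  would have equal weights, which genericity excludes. So an exchange always pairs a red edge with
  another one, and it shifts weight by a difference \<open>V\<^sub>i\<^sub>j - V\<^sub>w\<close>; as these differences are
  distinct, the optimal tree is unique (\<open>optimal_red_tree_unique\<close>), and the optimal trees with
  \<open>k\<close> and \<open>k - 1\<close> red edges differ by a single exchange (\<open>optimal_forests_nested\<close>). Passing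
  from \<open>g\<^sub>k\<close> to \<open>g\<^sub>k\<^sub>-\<^sub>1\<close> therefore drops the sink \<open>s\<close> and adds the edge \<open>{p, q}\<close>.

  Three exchanges now give the theorem. Let \<open>a = V\<^sub>p\<^sub>q\<close>.
  If an edge below \<open>a\<close> left the component of \<open>s\<close> in \<open>g\<^sub>k\<close>, it could replace \<open>{p, q}\<close> in
  \<open>g\<^sub>k\<^sub>-\<^sub>1\<close> (\<open>cheap_edge_stays_in_component\<close>); so the states that \<open>s\<close> reaches below \<open>a\<close>
  form a Freidlin cycle within that component.
  A state lower than \<open>s\<close> in the component could replace \<open>s\<close> as a sink
  (\<open>optimal_forest_sink_minimal\<close>).
  Finally, \<open>{p, q}\<close> closes a circuit through the root in the tree of \<open>g\<^sub>k\<close>. The circuit leads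
  from \<open>s\<close> to another sink, and by exchange with \<open>{p, q}\<close> its edges other than root edges are
  at most \<open>a\<close> while that sink is lower than \<open>s\<close> (\<open>lower_state_within_gap\<close>).
  Paths in the minimum spanning tree minimize the largest edge (\<open>min_spanning_tree_minimax\<close>), so every Freidlin cycle of a
  level above \<open>a\<close> contains this lower state.
\<close>

section \<open>Trees and symmetric exchange\<close>

abbreviation conn :: "'a set set \<Rightarrow> 'a \<Rightarrow> 'a \<Rightarrow> bool" where
  "conn F a b \<equiv> (a, b) \<in> (adj F)\<^sup>*"

lemma conn_edge: "{a, b} \<in> F \<Longrightarrow> conn F a b"
  by (auto simp: adj_def)

lemma conn_sym: "conn F a b \<Longrightarrow> conn F b a"
proof -
  have "sym (adj F)" by (auto simp: sym_def adj_def insert_commute)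
  then show "conn F a b \<Longrightarrow> conn F b a" by (meson sym_rtrancl symD)
qed

lemma conn_replace:
  assumes "conn P a b" "\<And>c d. {c, d} \<in> P \<Longrightarrow> conn F c d"
  shows "conn F a b"
  using assms(1)
proof (induction rule: rtrancl_induct)
  case (step y z)
  then show ?case using assms(2)[of y z] by (auto simp: adj_def intro: rtrancl_trans)
qed simp

lemma conn_mono: "conn P a b \<Longrightarrow> P \<subseteq> F \<Longrightarrow> conn F a b"
  by (erule conn_replace) (auto intro: conn_edge)

lemma conn_insertD:
  assumes "conn (insert {a, b} F) u v"
  shows "conn F u v \<or> conn F u a \<and> conn F b v \<or> conn F u b \<and> conn F a v"
  using assms
proof (induction rule: rtrancl_induct)
  case (step y z)
  from step.hyps(2) have "{y, z} \<in> F \<or> y = a \<and> z = b \<or> y = b \<and> z = a"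
    by (auto simp: adj_def doubleton_eq_iff)
  then show ?case
  proof (elim disjE)
    assume "{y, z} \<in> F"
    then have "conn F y z" by (rule conn_edge)
    then show ?thesis using step.IH by (meson rtrancl_trans)
  qed (use step.IH in \<open>auto intro: conn_sym rtrancl_trans\<close>)
qed simp

text \<open>
  If removing an edge disconnects \<open>u\<close> from \<open>v\<close>, then every connection uses the edge, and
  what lies before and after it avoids it.
\<close>

lemma conn_split_edge:
  assumes "conn F u v" "\<not> conn (F - {{a, b}}) u v"
  shows "conn (F - {{a, b}}) u a \<and> conn (F - {{a, b}}) b v \<or>
         conn (F - {{a, b}}) u b \<and> conn (F - {{a, b}}) a v"
  using assms conn_insertD[of u v a b "F - {{a, b}}"] conn_mono[of u v F "insert {a, b} (F - {{a, b}})"]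
  by blast

text \<open>
  A minimal connecting set serves as the edge set of a path, without a list of its states.
\<close>

lemma minimal_connecting_set:
  assumes "finite F" "conn F u v"
  shows "\<exists>P\<subseteq>F. conn P u v \<and> (\<forall>y\<in>P. \<not> conn (P - {y}) u v)"
  using assms
proof (induction F rule: finite_psubset_induct)
  case (psubset F)
  show ?case
  proof (cases "\<exists>y\<in>F. conn (F - {y}) u v")
    case True
    then obtain y where "y \<in> F" "conn (F - {y}) u v" by blast
    then have "\<exists>P\<subseteq>F - {y}. conn P u v \<and> (\<forall>y\<in>P. \<not> conn (P - {y}) u v)"
      using psubset.IH[of "F - {y}"] by blast
    then show ?thesis by blast
  qed (use psubset.prems in blast)
qed

text \<open>
  Counting edges instead of excluding cycles reduces "an exchange yields a tree again" to
  connectedness.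
\<close>

definition tree :: "'a set \<Rightarrow> 'a set set \<Rightarrow> bool" where
  "tree X F \<longleftrightarrow> finite X \<and> simple_graph X F \<and> connected_graph X F \<and> card F + 1 = card X"

lemma simple_graph_finite: "simple_graph X F \<Longrightarrow> finite X \<Longrightarrow> finite F"
  by (rule finite_subset[of _ "Pow X"]) (auto simp: simple_graph_def)

lemma simple_graphE:
  assumes "simple_graph X F" "y \<in> F"
  obtains a b where "y = {a, b}" "a \<in> X" "b \<in> X" "a \<noteq> b"
  using assms unfolding simple_graph_def by blast

lemma simple_graph_subset: "simple_graph X F \<Longrightarrow> y \<in> F \<Longrightarrow> y \<subseteq> X"
  by (auto simp: simple_graph_def)

lemma connected_graphI_root:
  assumes "r \<in> X" "\<And>i. i \<in> X \<Longrightarrow> conn F i r"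
  shows "connected_graph X F"
  unfolding connected_graph_def
proof (intro conjI ballI)
  fix i j assume "i \<in> X" "j \<in> X"
  then show "conn F i j" using assms(2)[of i] conn_sym[OF assms(2)[of j]] by (meson rtrancl_trans)
qed (use assms(1) in blast)

text \<open>
  Sending every state to a neighbour nearer to \<open>r\<close> is injective on edges, as the distance
  orients each edge; this bounds the number of edges from below and, in a tree, exhausts them.
\<close>

lemma connected_graph_parents:
  assumes "connected_graph X F" "simple_graph X F" "r \<in> X"
  obtains par and d :: "'a \<Rightarrow> nat" where
    "\<And>i. i \<in> X - {r} \<Longrightarrow> {i, par i} \<in> F \<and> par i \<in> X \<and> d (par i) < d i"
    "inj_on (\<lambda>i. {i, par i}) (X - {r})"
proof -
  define d where "d i = (LEAST n. (i, r) \<in> adj F ^^ n)" for i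
  have "\<exists>j. {i, j} \<in> F \<and> j \<in> X \<and> d j < d i" if i: "i \<in> X - {r}" for i
  proof -
    have "(i, r) \<in> (adj F)\<^sup>*" using assms i by (auto simp: connected_graph_def)
    then have "\<exists>n. (i, r) \<in> adj F ^^ n" by (rule rtrancl_imp_relpow)
    then have "(i, r) \<in> adj F ^^ d i" unfolding d_def by (rule LeastI_ex)
    moreover from this have "d i \<noteq> 0" using i by (cases "d i") auto
    ultimately obtain m where m: "d i = Suc m" "(i, r) \<in> adj F ^^ Suc m"
      by (metis not0_implies_Suc)
    then obtain j where j: "(i, j) \<in> adj F" "(j, r) \<in> adj F ^^ m"
      by (meson relpow_Suc_D2)
    have "d j \<le> m" unfolding d_def using j(2) by (rule Least_le)
    then show ?thesis using j(1) m(1) assms(2)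
      by (intro exI[of _ j]) (auto simp: adj_def simple_graph_def doubleton_eq_iff)
  qed
  then obtain par where par: "\<And>i. i \<in> X - {r} \<Longrightarrow> {i, par i} \<in> F \<and> par i \<in> X \<and> d (par i) < d i"
    by metis
  have "inj_on (\<lambda>i. {i, par i}) (X - {r})"
  proof (rule inj_onI)
    fix i j assume "i \<in> X - {r}" "j \<in> X - {r}" "{i, par i} = {j, par j}"
    then show "i = j" using par[of i] par[of j] by (auto simp: doubleton_eq_iff)
  qed
  then show thesis using par that by blast
qed

lemma connected_graph_card:
  assumes "connected_graph X F" "simple_graph X F" "finite X"
  shows "card X \<le> card F + 1"
proof -
  obtain r where r: "r \<in> X" using assms(1) by (auto simp: connected_graph_def)
  obtain par and d :: "'a \<Rightarrow> nat" where
    par: "\<And>i. i \<in> X - {r} \<Longrightarrow> {i, par i} \<in> F \<and> par i \<in> X \<and> d (par i) < d i"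
    "inj_on (\<lambda>i. {i, par i}) (X - {r})"
    using connected_graph_parents[OF assms(1,2) r] by blast
  have "card (X - {r}) = card ((\<lambda>i. {i, par i}) ` (X - {r}))" using par(2) by (simp add: card_image)
  also have "\<dots> \<le> card F" using par(1) assms by (intro card_mono) (auto intro: simple_graph_finite)
  finally show ?thesis using r assms(3) by simp
qed

lemma tree_conn: "tree X F \<Longrightarrow> a \<in> X \<Longrightarrow> b \<in> X \<Longrightarrow> conn F a b"
  by (auto simp: tree_def connected_graph_def)

lemma tree_finite: "tree X F \<Longrightarrow> finite F"
  by (auto simp: tree_def intro: simple_graph_finite)

text \<open>
  Otherwise the remaining edges would still connect all states, but there are too few of them.
\<close>

lemma tree_edge_bridge:
  assumes "tree X F" "{a, b} \<in> F"
  shows "\<not> conn (F - {{a, b}}) a b"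
proof
  assume c: "conn (F - {{a, b}}) a b"
  have "conn (F - {{a, b}}) i j" if "conn F i j" for i j
    using that
  proof (rule conn_replace)
    fix x y assume "{x, y} \<in> F"
    then show "conn (F - {{a, b}}) x y"
      by (cases "{x, y} = {a, b}") (use c conn_sym[OF c] in \<open>auto simp: doubleton_eq_iff intro: conn_edge\<close>)
  qed
  then have "connected_graph X (F - {{a, b}})" using assms(1) by (auto simp: tree_def connected_graph_def)
  moreover have "simple_graph X (F - {{a, b}})" using assms(1) by (auto simp: tree_def simple_graph_def)
  ultimately have "card X \<le> card (F - {{a, b}}) + 1"
    using assms(1) by (intro connected_graph_card) (auto simp: tree_def)
  moreover have "card (F - {{a, b}}) < card F" using assms(2) tree_finite[OF assms(1)] by (intro card_Diff1_less)
  ultimately show False using assms(1) by (auto simp: tree_def)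
qed

text \<open>
  The set \<open>P\<close> is the path from \<open>u\<close> to \<open>v\<close>. Were \<open>u\<close> and \<open>v\<close> connected without its edge
  \<open>y\<close>, then going round through \<open>u\<close> and \<open>v\<close> would connect the ends of \<open>y\<close> without \<open>y\<close>.
\<close>

lemma tree_circuit:
  assumes "tree X F" "u \<in> X" "v \<in> X"
  obtains P where "P \<subseteq> F" "conn P u v" "\<And>y. y \<in> P \<Longrightarrow> \<not> conn (F - {y}) u v"
proof -
  obtain P where P: "P \<subseteq> F" "conn P u v" "\<forall>y\<in>P. \<not> conn (P - {y}) u v"
    using minimal_connecting_set[OF tree_finite[OF assms(1)] tree_conn[OF assms]] by blast
  have "\<not> conn (F - {y}) u v" if y: "y \<in> P" for y
  proof
    assume uv: "conn (F - {y}) u v"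
    obtain a b where ab: "y = {a, b}" using assms(1) P(1) y by (auto simp: tree_def elim: simple_graphE)
    have "conn (F - {y}) w z" if "conn (P - {y}) w z" for w z
      using that by (rule conn_mono) (use P(1) in auto)
    then have "conn (F - {y}) u a \<and> conn (F - {y}) b v \<or> conn (F - {y}) u b \<and> conn (F - {y}) a v"
      using conn_split_edge[of u v P a b] P(2,3) y ab by blast
    then have "conn (F - {y}) a b" using uv by (meson conn_sym rtrancl_trans)
    then show False using tree_edge_bridge[OF assms(1), of a b] ab y P(1) by blast
  qed
  then show thesis using P that by blast
qed

lemma tree_exchange:
  assumes "tree X F" "y \<in> F" "a \<in> X" "b \<in> X" "\<not> conn (F - {y}) a b"
  shows "tree X (insert {a, b} (F - {y}))" "{a, b} \<notin> F - {y}"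
proof -
  let ?F = "insert {a, b} (F - {y})"
  show new: "{a, b} \<notin> F - {y}" using assms(5) conn_edge by metis
  obtain c d where cd: "y = {c, d}" using assms by (auto simp: tree_def elim: simple_graphE)
  have "a \<noteq> b" using assms(5) by auto
  then have simple: "simple_graph X ?F"
    using assms by (auto simp: tree_def simple_graph_def)
  have up: "conn ?F i j" if "conn (F - {y}) i j" for i j using that by (rule conn_mono) auto
  have "conn ?F a b" by (rule conn_edge) simp
  moreover have "conn (F - {y}) a c \<and> conn (F - {y}) d b \<or> conn (F - {y}) a d \<and> conn (F - {y}) c b"
    using conn_split_edge[of a b F c d] tree_conn[OF assms(1,3,4)] assms(5) cd by blast
  ultimately have "conn ?F c d" by (meson up conn_sym rtrancl_trans)
  then have *: "conn ?F i j" if "{i, j} \<in> F" for i j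
    using that cd by (cases "{i, j} = y") (auto simp: doubleton_eq_iff intro: conn_sym conn_edge)
  have "conn ?F i j" if "conn F i j" for i j using that * by (rule conn_replace)
  then have "connected_graph X ?F" using assms(1) by (auto simp: tree_def connected_graph_def)
  moreover have "card ?F = card F"
    using new assms(2) tree_finite[OF assms(1)] card_Suc_Diff1[of F y] by simp
  ultimately show "tree X ?F" using simple assms(1) by (auto simp: tree_def)
qed

text \<open>
  Removing \<open>x\<close> splits \<open>B\<close> in two parts, and the path in \<open>B'\<close> between the ends of \<open>x\<close> has
  an edge \<open>y\<close> crossing between them. It reconnects \<open>B\<close>, and it lies on the circuit that \<open>x\<close>
  closes in \<open>B'\<close>.
\<close>

lemma tree_symmetric_exchange:
  assumes "tree X B" "tree X B'" "x \<in> B - B'"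
  obtains y where "y \<in> B' - B" "tree X (insert y (B - {x}))" "tree X (insert x (B' - {y}))"
proof -
  obtain a b where ab: "x = {a, b}" "a \<in> X" "b \<in> X"
    using assms by (auto simp: tree_def elim: simple_graphE)
  obtain P where P: "P \<subseteq> B'" "conn P a b" "\<And>y. y \<in> P \<Longrightarrow> \<not> conn (B' - {y}) a b"
    using tree_circuit[OF assms(2) ab(2,3)] by blast
  have "\<not> conn (B - {x}) a b" using tree_edge_bridge[OF assms(1), of a b] ab assms(3) by blast
  then obtain c d where cd: "{c, d} \<in> P" "\<not> conn (B - {x}) c d"
    using conn_replace[OF P(2), of "B - {x}"] by blast
  have "{c, d} \<in> B'" using cd(1) P(1) by blast
  then have "{c, d} \<subseteq> X" using simple_graph_subset[of X B' "{c, d}"] assms(2) unfolding tree_def by blast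
  then have "c \<in> X" "d \<in> X" by simp_all
  then have "tree X (insert {c, d} (B - {x}))" "{c, d} \<notin> B - {x}"
    using tree_exchange[OF assms(1), of x c d] cd(2) assms(3) by auto
  moreover have "tree X (insert x (B' - {{c, d}}))"
    using tree_exchange(1)[OF assms(2), of "{c, d}" a b] P cd(1) ab by blast
  ultimately show thesis using that[of "{c, d}"] cd(1) P(1) assms(3) by blast
qed

section \<open>Optimal trees with a prescribed number of red edges\<close>

definition red_tree :: "'a set \<Rightarrow> 'a set set \<Rightarrow> 'a set set \<Rightarrow> nat \<Rightarrow> 'a set set \<Rightarrow> bool" where
  "red_tree X G R j B \<longleftrightarrow> tree X B \<and> B \<subseteq> G \<and> card (B \<inter> R) = j"

definition optimal_red_tree ::
    "'a set \<Rightarrow> 'a set set \<Rightarrow> 'a set set \<Rightarrow> ('a set \<Rightarrow> real) \<Rightarrow> nat \<Rightarrow> 'a set set \<Rightarrow> bool" where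
  "optimal_red_tree X G R c j B \<longleftrightarrow>
     red_tree X G R j B \<and> (\<forall>B'. red_tree X G R j B' \<longrightarrow> sum c B \<le> sum c B')"

text \<open>
  In the enlarged graph the red weights are the \<open>V\<^sub>i\<close> and the others the \<open>V\<^sub>i\<^sub>j\<close>; an exchange
  of edges of different colours shifts weight by one of the differences.
\<close>

definition generic_colouring :: "'a set set \<Rightarrow> 'a set set \<Rightarrow> ('a set \<Rightarrow> real) \<Rightarrow> bool" where
  "generic_colouring G R c \<longleftrightarrow>
     inj_on c (G \<inter> R) \<and> inj_on c (G - R) \<and>
     inj_on (\<lambda>(e, w). c e - c w) ((G - R) \<times> (G \<inter> R))"

lemma sum_exchange:
  fixes c :: "'b \<Rightarrow> real"
  assumes "finite B" "x \<in> B" "y \<notin> B - {x}"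
  shows "sum c (insert y (B - {x})) = sum c B - c x + c y"
  using sum.insert[OF finite_Diff[OF assms(1)] assms(3), of c] sum.remove[OF assms(1,2), of c] by simp

lemma card_red_exchange:
  assumes "finite B" "x \<in> B" "y \<notin> B - {x}"
  shows "card (insert y (B - {x}) \<inter> R) + (if x \<in> R then 1 else 0) =
         card (B \<inter> R) + (if y \<in> R then 1 else 0)"
proof -
  have "insert y (B - {x}) \<inter> R = (if y \<in> R then insert y (B \<inter> R - {x}) else B \<inter> R - {x})" by auto
  moreover have "y \<notin> B \<inter> R - {x}" "finite (B \<inter> R)" using assms by auto
  moreover have "card (B \<inter> R - {x}) + (if x \<in> R then 1 else 0) = card (B \<inter> R)"
    using assms card_Suc_Diff1[of "B \<inter> R" x] by auto
  ultimately show ?thesis by auto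
qed

text \<open>
  The equation on \<open>j'\<close> avoids subtraction of natural numbers and covers all four
  combinations of colours.
\<close>

lemma red_tree_exchange:
  fixes c :: "'a set \<Rightarrow> real"
  assumes "red_tree X G R j B" "x \<in> B" "y \<in> G" "y \<notin> B - {x}" "tree X (insert y (B - {x}))"
    and "j' + (if x \<in> R then 1 else 0) = j + (if y \<in> R then 1 else 0)"
  shows "red_tree X G R j' (insert y (B - {x}))"
    and "sum c (insert y (B - {x})) = sum c B - c x + c y"
proof -
  have B: "finite B" "B \<subseteq> G" "card (B \<inter> R) = j" using assms(1) tree_finite by (auto simp: red_tree_def)
  have "card (insert y (B - {x}) \<inter> R) = j'"
    using card_red_exchange[OF B(1) assms(2,4), of R] assms(6) B(3) by linarith
  moreover have "insert y (B - {x}) \<subseteq> G" using B(2) assms(3) by blast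
  ultimately show "red_tree X G R j' (insert y (B - {x}))" using assms(5) by (simp add: red_tree_def)
  show "sum c (insert y (B - {x})) = sum c B - c x + c y" by (rule sum_exchange[OF B(1) assms(2,4)])
qed

lemma optimal_red_tree_exchange:
  assumes "optimal_red_tree X G R c j B" "x \<in> B" "y \<in> G" "y \<notin> B - {x}"
    and "tree X (insert y (B - {x}))" "x \<in> R \<longleftrightarrow> y \<in> R"
  shows "c x \<le> c y"
proof -
  have B: "red_tree X G R j B" using assms(1) by (simp add: optimal_red_tree_def)
  have "j + (if x \<in> R then 1 else 0) = j + (if y \<in> R then 1 else 0)" using assms(6) by simp
  note new = red_tree_exchange[OF B assms(2-5) this]
  have "sum c B \<le> sum c (insert y (B - {x}))" using assms(1) new(1) by (simp add: optimal_red_tree_def)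
  then show ?thesis using new(2)[of c] by simp
qed

text \<open>
  An exchange of edges of equal colour would preserve both numbers of red edges, so
  optimality on both sides would force equal weights.
\<close>

lemma optimal_red_trees_exchange:
  assumes gen: "generic_colouring G R c"
    and opt: "optimal_red_tree X G R c j B" "optimal_red_tree X G R c j' B'"
    and x: "x \<in> B - B'"
  obtains y where "y \<in> B' - B" "tree X (insert y (B - {x}))" "tree X (insert x (B' - {y}))"
    "x \<in> R \<longleftrightarrow> y \<notin> R"
proof -
  have "tree X B" "tree X B'" using opt by (auto simp: optimal_red_tree_def red_tree_def)
  then obtain y where y: "y \<in> B' - B" "tree X (insert y (B - {x}))" "tree X (insert x (B' - {y}))"
    using x tree_symmetric_exchange by metis
  have G: "x \<in> G" "y \<in> G" using opt x y by (auto simp: optimal_red_tree_def red_tree_def)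
  have "x \<in> R \<longleftrightarrow> y \<notin> R"
  proof (rule ccontr)
    assume same: "\<not> (x \<in> R \<longleftrightarrow> y \<notin> R)"
    then have "c x \<le> c y" "c y \<le> c x"
      using optimal_red_tree_exchange[OF opt(1), of x y] optimal_red_tree_exchange[OF opt(2), of y x]
        x y G by auto
    then have "c x = c y" by simp
    moreover have "inj_on c (G \<inter> R)" "inj_on c (G - R)" using gen by (auto simp: generic_colouring_def)
    ultimately have "x = y" using same G by (cases "x \<in> R") (auto dest: inj_onD)
    then show False using x y by blast
  qed
  then show thesis using y that by blast
qed

text \<open>
  The two given exchanges lead to a tree \<open>?D\<close> with one red edge less than \<open>B\<close> and a tree
  \<open>?A\<close> with one more. The only edges of \<open>?D\<close> outside \<open>?A\<close> are \<open>e\<close> and \<open>e'\<close>, which are not red.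
  So exchanging \<open>w\<close> between \<open>?A\<close> and \<open>?D\<close> makes both numbers of red edges equal to \<open>j\<close> again,
  and the total weight of the two resulting trees is at least twice that of \<open>B\<close>.
\<close>

lemma exchange_difference_le:
  assumes opt: "optimal_red_tree X G R c j B"
    and in_B: "w \<in> B \<inter> R" "e' \<in> B - R" and new: "w' \<in> G \<inter> R - B" "e \<in> G - R - B"
    and trees: "tree X (insert e (B - {w}))" "tree X (insert w' (B - {e'}))"
  shows "c e' - c w' \<le> c e - c w"
proof -
  let ?D = "insert e (B - {w})" and ?A = "insert w' (B - {e'})"
  have red: "red_tree X G R j B" using opt by (simp add: optimal_red_tree_def)
  then have B: "finite B" "B \<subseteq> G" "card (B \<inter> R) = j"
    using tree_finite by (auto simp: red_tree_def)
  have "w \<in> ?A - ?D" using in_B new by auto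
  then obtain y where y: "y \<in> ?D - ?A" "tree X (insert y (?A - {w}))" "tree X (insert w (?D - {y}))"
    using tree_symmetric_exchange[OF trees(2,1)] by blast
  have y_cases: "y = e \<or> y = e'" using y(1) in_B new by auto
  have wA: "w \<in> ?A" "y \<in> G" "y \<notin> ?A - {w}" and yD: "y \<in> ?D" "w \<in> G" "w \<notin> ?D - {y}"
    and R: "y \<notin> R" "w \<in> R" "e \<notin> R" "e' \<notin> R" "w' \<in> R"
    using y(1) y_cases in_B new B by auto
  have jj: "Suc (j - 1) = j" using R(2) in_B B(1,3) card_gt_0_iff[of "B \<inter> R"] by auto
  have D: "red_tree X G R (j - 1) ?D" "sum c ?D = sum c B - c w + c e"
    by (rule red_tree_exchange[OF red _ _ _ trees(1)]; use in_B new R jj in simp)+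
  have A: "red_tree X G R (Suc j) ?A" "sum c ?A = sum c B - c e' + c w'"
    by (rule red_tree_exchange[OF red _ _ _ trees(2), where j' = "Suc j"]; use in_B new R in simp)+
  have A': "red_tree X G R j (insert y (?A - {w}))" "sum c (insert y (?A - {w})) = sum c ?A - c w + c y"
    by (rule red_tree_exchange[OF A(1) wA y(2), where j' = j]; use R in simp)+
  have D': "red_tree X G R j (insert w (?D - {y}))" "sum c (insert w (?D - {y})) = sum c ?D - c y + c w"
    by (rule red_tree_exchange[OF D(1) yD y(3), where j' = j]; use R jj in simp)+
  have "sum c B \<le> sum c (insert y (?A - {w}))" "sum c B \<le> sum c (insert w (?D - {y}))"
    using opt A'(1) D'(1) unfolding optimal_red_tree_def by blast+
  then show ?thesis using A(2) D(2) A'(2) D'(2) by linarith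
qed

text \<open>
  Two distinct optimal trees would allow two exchanges of opposite direction, with \<open>w, e\<close>
  and with \<open>w', e'\<close>. Comparing the differences of weights within \<open>B\<close> and within \<open>B'\<close> gives
  both inequalities between them, hence equality, against genericity.
\<close>

lemma optimal_red_tree_unique:
  assumes gen: "generic_colouring G R c"
    and opt: "optimal_red_tree X G R c j B" "optimal_red_tree X G R c j B'"
  shows "B = B'"
proof (rule ccontr)
  assume neq: "B \<noteq> B'"
  have B: "finite B" "B \<subseteq> G" "card (B \<inter> R) = j" and B': "finite B'" "B' \<subseteq> G" "card (B' \<inter> R) = j"
    using opt tree_finite by (auto simp: optimal_red_tree_def red_tree_def)
  have card: "card B = card B'" using opt by (auto simp: optimal_red_tree_def red_tree_def tree_def)
  have "card (B \<inter> R) + card (B - R) = card (B' \<inter> R) + card (B' - R)"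
    using card B B' by (metis card_Int_Diff)
  then have "card (B - R) = card (B' - R)" using B B' by simp
  have red_iff: "B \<inter> R \<subseteq> B' \<longleftrightarrow> B' \<inter> R \<subseteq> B"
    using B B' card_subset_eq[of "B \<inter> R" "B' \<inter> R"] card_subset_eq[of "B' \<inter> R" "B \<inter> R"] by auto
  have other_iff: "B - R \<subseteq> B' \<longleftrightarrow> B' - R \<subseteq> B"
    using B B' \<open>card (B - R) = card (B' - R)\<close>
      card_subset_eq[of "B - R" "B' - R"] card_subset_eq[of "B' - R" "B - R"] by auto
  obtain x where x: "x \<in> B - B'" using neq card_subset_eq[of B' B] card B' by auto
  obtain y where y: "y \<in> B' - B" "x \<in> R \<longleftrightarrow> y \<notin> R"
    using optimal_red_trees_exchange[OF gen opt x] by blast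
  \<comment> \<open>\<open>B\<close> and \<open>B'\<close> have equally many edges of each colour, and \<open>x\<close> and \<open>y\<close> have different colours.\<close>
  have "\<not> B \<inter> R \<subseteq> B'" "\<not> B - R \<subseteq> B'" using x y red_iff other_iff by blast+
  then obtain w e' where we': "w \<in> B \<inter> R - B'" "e' \<in> B - R - B'" by blast
  obtain e where e: "e \<in> B' - B" "tree X (insert e (B - {w}))" "tree X (insert w (B' - {e}))" "e \<notin> R"
    using optimal_red_trees_exchange[OF gen opt, of w] we' by blast
  obtain w' where w': "w' \<in> B' - B" "tree X (insert w' (B - {e'}))" "tree X (insert e' (B' - {w'}))" "w' \<in> R"
    using optimal_red_trees_exchange[OF gen opt, of e'] we' by blast
  have "c e' - c w' \<le> c e - c w"
    using exchange_difference_le[OF opt(1), of w e' w' e] we' e w' B' by blast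
  moreover have "c e - c w \<le> c e' - c w'"
    using exchange_difference_le[OF opt(2), of w' e w e'] we' e w' B by blast
  ultimately have "c e - c w = c e' - c w'" by simp
  then have "(e, w) = (e', w')"
    using gen we' e w' B(2) B'(2) unfolding generic_colouring_def
    by (intro inj_onD[of "\<lambda>(e, w). c e - c w" "(G - R) \<times> (G \<inter> R)"]) auto
  then show False using e we' by blast
qed

text \<open>
  The exchange turns \<open>B\<close> and \<open>B'\<close> into trees that have each other's numbers of red edges and
  the same total weight, so both are optimal, and uniqueness identifies the smaller one with \<open>B'\<close>.
\<close>

lemma optimal_red_trees_nested:
  assumes gen: "generic_colouring G R c"
    and opt: "optimal_red_tree X G R c (Suc j) B" "optimal_red_tree X G R c j B'"
    and w: "w \<in> B - B'" "w \<in> R"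
  obtains e where "e \<in> G - R" "e \<notin> B" "B' = insert e (B - {w})"
proof -
  obtain e where e: "e \<in> B' - B" "tree X (insert e (B - {w}))" "tree X (insert w (B' - {e}))" "e \<notin> R"
    using optimal_red_trees_exchange[OF gen opt w(1)] w(2) by blast
  have red: "red_tree X G R (Suc j) B" "red_tree X G R j B'" using opt by (auto simp: optimal_red_tree_def)
  then have G: "B \<subseteq> G" "B' \<subseteq> G" by (auto simp: red_tree_def)
  have wB: "w \<in> B" "e \<in> G" "e \<notin> B - {w}" and eB: "e \<in> B'" "w \<in> G" "w \<notin> B' - {e}"
    using w e G by auto
  have D: "red_tree X G R j (insert e (B - {w}))" "sum c (insert e (B - {w})) = sum c B - c w + c e"
    by (rule red_tree_exchange[OF red(1) wB e(2), where j' = j]; use w e in simp)+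
  have A: "red_tree X G R (Suc j) (insert w (B' - {e}))" "sum c (insert w (B' - {e})) = sum c B' - c e + c w"
    by (rule red_tree_exchange[OF red(2) eB e(3), where j' = "Suc j"]; use w e in simp)+
  have "sum c B \<le> sum c (insert w (B' - {e}))" using opt(1) A(1) by (auto simp: optimal_red_tree_def)
  then have "sum c (insert e (B - {w})) \<le> sum c B'" using A(2) D(2) by simp
  then have "optimal_red_tree X G R c j (insert e (B - {w}))"
    using opt(2) D(1) unfolding optimal_red_tree_def by (meson order_trans)
  then have "B' = insert e (B - {w})" using optimal_red_tree_unique[OF gen opt(2)] by blast
  then show thesis using that e G by blast
qed

section \<open>Paths in trees and the minimax property\<close>

lemma path_edges_simps [simp]:
  "path_edges [] = {}" "path_edges [x] = {}"
  "path_edges (x # y # xs) = insert {x, y} (path_edges (y # xs))"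
  by (auto simp: path_edges_def)

lemma path_edges_subset: "e \<in> path_edges p \<Longrightarrow> e \<subseteq> set p"
  by (induction p rule: induct_list012) auto

lemma finite_path_edges [simp]: "finite (path_edges p)"
  by (simp add: path_edges_def)

lemma successively_iff_path_edges: "successively (\<lambda>i j. {i, j} \<in> F) p \<longleftrightarrow> path_edges p \<subseteq> F"
  by (induction p rule: induct_list012) auto

lemma conn_path_edges: "p \<noteq> [] \<Longrightarrow> conn (path_edges p) (hd p) (last p)"
proof (induction p rule: induct_list012)
  case (3 x y xs)
  have "conn (path_edges (x # y # xs)) y (last (y # xs))"
    using conn_mono[OF 3(2) subset_insertI[of _ "{x, y}"]] by simp
  then have "conn (path_edges (x # y # xs)) x (last (y # xs))"
    by (rule rtrancl_trans[OF conn_edge, rotated]) simp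
  then show ?case by simp
qed auto

lemma conn_path_edges_mono: "p \<noteq> [] \<Longrightarrow> path_edges p \<subseteq> F \<Longrightarrow> conn F (hd p) (last p)"
  using conn_mono[OF conn_path_edges] .

lemma conn_imp_path:
  assumes "conn F a b"
  shows "\<exists>p. path F a p b"
  using assms
proof (induction rule: rtrancl_induct)
  case base
  show ?case by (intro exI[of _ "[a]"]) (simp add: path_def)
next
  case (step y z)
  then obtain p where p: "path F a p y" by blast
  show ?case
  proof (cases "z \<in> set p")
    case True
    then obtain p1 p2 where "p = p1 @ z # p2" by (auto simp: in_set_conv_decomp)
    then have "path F a (p1 @ [z]) z"
      using p by (auto simp: path_def successively_append_iff hd_append split: if_splits)
    then show ?thesis by blast
  next
    case False
    have "{y, z} \<in> F" using step.hyps(2) by (simp add: adj_def)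
    then have "path F a (p @ [z]) z" using p False by (auto simp: path_def successively_append_iff)
    then show ?thesis by blast
  qed
qed

text \<open>
  If two paths took different first edges \<open>{a, c}\<close> and \<open>{a, c'}\<close>, they would together connect
  \<open>a\<close> with \<open>c\<close> without using \<open>{a, c}\<close>.
\<close>

lemma path_unique:
  assumes bridges: "\<And>a b. {a, b} \<in> F \<Longrightarrow> \<not> conn (F - {{a, b}}) a b"
  shows "path F a p b \<Longrightarrow> path F a q b \<Longrightarrow> p = q"
proof (induction p arbitrary: a q)
  case Nil
  then show ?case by (simp add: path_def)
next
  case (Cons a' p)
  then have [simp]: "a' = a" by (simp add: path_def)
  obtain q' where q: "q = a # q'" using Cons.prems(2) by (cases q) (auto simp: path_def)
  show ?case
  proof (cases "p = [] \<or> q' = []")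
    case True
    then have "p = [] \<and> q' = []"
      using Cons.prems q last_in_set[of p] last_in_set[of q'] by (auto simp: path_def split: if_splits)
    then show ?thesis using q by simp
  next
    case False
    then obtain c p' c' q'' where pq: "p = c # p'" "q' = c' # q''" by (meson neq_Nil_conv)
    have p: "path F c p b" "a \<notin> set p" "{a, c} \<in> F"
      using Cons.prems(1) pq by (auto simp: path_def successively_Cons)
    have q': "path F c' q' b" "a \<notin> set q'" "{a, c'} \<in> F"
      using Cons.prems(2) pq q by (auto simp: path_def successively_Cons)
    have "c = c'"
    proof (rule ccontr)
      assume "c \<noteq> c'"
      have "conn (F - {{a, c}}) (hd p) (last p)"
        by (rule conn_path_edges_mono)
          (use p path_edges_subset[of "{a, c}" p] in \<open>auto simp: path_def successively_iff_path_edges\<close>)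
      moreover have "conn (F - {{a, c}}) (hd q') (last q')"
        by (rule conn_path_edges_mono)
          (use q' path_edges_subset[of "{a, c}" q'] in \<open>auto simp: path_def successively_iff_path_edges\<close>)
      moreover have "conn (F - {{a, c}}) a c'"
        using q'(3) \<open>c \<noteq> c'\<close> by (intro conn_edge) (auto simp: doubleton_eq_iff)
      ultimately have "conn (F - {{a, c}}) c b" "conn (F - {{a, c}}) a b"
        using p(1) q'(1) by (auto simp: path_def)
      then show False using bridges[OF p(3)] by (meson conn_sym rtrancl_trans)
    qed
    then have "p = q'" using Cons.IH[OF p(1)] q'(1) by simp
    then show ?thesis using q by simp
  qed
qed

lemma tree_path_eq:
  assumes "tree X F" "path F a p b"
  shows "tree_path F a b = p"
  unfolding tree_path_def
proof (rule the_equality[of "\<lambda>p. path F a p b", OF assms(2)])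
  fix q assume "path F a q b"
  then show "q = p" using path_unique[of F, OF tree_edge_bridge[OF assms(1)]] assms(2) by blast
qed

lemma tree_imp_spanning_tree:
  assumes "tree S T" "T \<subseteq> E"
  shows "spanning_tree S E T"
  unfolding spanning_tree_def
proof (intro conjI notI)
  assume "\<exists>p. cycle T p"
  then obtain p where p: "cycle T p" ..
  then obtain a c d p' where acd: "p = a # c # d # p'"
    by (auto simp: cycle_def numeral_3_eq_3 Suc_le_length_iff)
  let ?z = "last (d # p')"
  have z: "?z \<in> set (d # p')" by (rule last_in_set) simp
  have "{a, ?z} \<notin> path_edges (c # d # p')" using path_edges_subset[of "{a, ?z}" "c # d # p'"] p
    unfolding cycle_def acd by auto
  moreover have "{a, ?z} \<noteq> {a, c}" using p z unfolding cycle_def acd by (auto simp: doubleton_eq_iff)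
  ultimately have "{a, ?z} \<notin> path_edges p" using acd by auto
  then have "conn (T - {{a, ?z}}) (hd p) (last p)"
    using p by (intro conn_path_edges_mono) (auto simp: cycle_def successively_iff_path_edges)
  moreover have "{a, ?z} \<in> T" using p acd by (auto simp: cycle_def insert_commute)
  ultimately show False using tree_edge_bridge[OF assms(1), of a ?z] acd by auto
qed (use assms in \<open>auto simp: tree_def\<close>)

text \<open>
  The edges to the parents with respect to a state \<open>r\<close> already connect \<open>S\<close>; any further edge
  would close a cycle. So there is one edge for each state other than \<open>r\<close>.
\<close>

lemma spanning_tree_imp_tree:
  assumes "spanning_tree S E T" "simple_graph S E" "finite S"
  shows "tree S T"
proof -
  have T: "T \<subseteq> E" "connected_graph S T" "\<And>p. \<not> cycle T p" using assms(1) by (auto simp: spanning_tree_def)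
  have simple: "simple_graph S T" using assms(2) T(1) by (auto simp: simple_graph_def)
  obtain r where r: "r \<in> S" using T(2) by (auto simp: connected_graph_def)
  obtain par and d :: "'a \<Rightarrow> nat" where
    par: "\<And>i. i \<in> S - {r} \<Longrightarrow> {i, par i} \<in> T \<and> par i \<in> S \<and> d (par i) < d i"
    "inj_on (\<lambda>i. {i, par i}) (S - {r})"
    using connected_graph_parents[OF T(2) simple r] by blast
  let ?P = "(\<lambda>i. {i, par i}) ` (S - {r})"
  have to_root: "conn ?P i r" if "i \<in> S" for i
    using that
  proof (induction "d i" arbitrary: i rule: less_induct)
    case less
    show ?case
    proof (cases "i = r")
      case False
      then have "conn ?P i (par i)" using less.prems by (intro conn_edge) blast
      moreover have "conn ?P (par i) r" using less par(1)[of i] False by blast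
      ultimately show ?thesis by (rule rtrancl_trans)
    qed simp
  qed
  have "e \<in> ?P" if e: "e \<in> T" for e
  proof (rule ccontr)
    assume "e \<notin> ?P"
    obtain a b where ab: "e = {a, b}" "a \<in> S" "b \<in> S" "a \<noteq> b" using simple e by (rule simple_graphE)
    have "conn ?P a b" using to_root[OF ab(2)] conn_sym[OF to_root[OF ab(3)]] by (rule rtrancl_trans)
    moreover have "?P \<subseteq> T - {e}" using par(1) \<open>e \<notin> ?P\<close> by blast
    ultimately have "conn (T - {e}) a b" by (rule conn_mono)
    then obtain p where p: "path (T - {e}) a p b" using conn_imp_path[of a b "T - {e}"] by blast
    have "cycle T p"
      unfolding cycle_def
    proof (intro conjI)
      show "3 \<le> length p"
      proof -
        have "length p \<noteq> 0" "length p \<noteq> Suc 0" "length p \<noteq> Suc (Suc 0)"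
          using p ab by (auto simp: path_def length_Suc_conv)
        then show ?thesis by linarith
      qed
      show "{last p, hd p} \<in> T" using p e ab(1) by (auto simp: path_def insert_commute)
      show "successively (\<lambda>i j. {i, j} \<in> T) p"
        using p unfolding path_def successively_iff_path_edges by blast
    qed (use p in \<open>simp add: path_def\<close>)
    then show False using T(3) by blast
  qed
  then have "T = ?P" using par(1) by auto
  then have "card T = card (S - {r})" using par(2) by (simp add: card_image)
  then show ?thesis using T(2) simple assms(3) r card_Suc_Diff1[OF assms(3) r] by (simp add: tree_def)
qed

lemma path_max_le_iff: "path_max T U a b \<le> ereal c \<longleftrightarrow> (\<forall>e\<in>path_edges (tree_path T a b). U e \<le> c)"
  unfolding path_max_def by (subst Max_le_iff) auto

lemma path_max_less_iff: "path_max T U a b < ereal c \<longleftrightarrow> (\<forall>e\<in>path_edges (tree_path T a b). U e < c)"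
  unfolding path_max_def by (subst Max_less_iff) auto

lemma path_max_lessD:
  assumes "tree S T" "a \<in> S" "b \<in> S" "path_max T U a b < ereal c"
  shows "conn {e \<in> T. U e < c} a b"
proof -
  obtain p where p: "path T a p b" using conn_imp_path[OF tree_conn[OF assms(1-3)]] by blast
  then have "tree_path T a b = p" using tree_path_eq[OF assms(1)] by blast
  then have "path_edges p \<subseteq> {e \<in> T. U e < c}"
    using p assms(4) unfolding path_max_less_iff by (auto simp: path_def successively_iff_path_edges)
  then show ?thesis using p conn_path_edges_mono[of p] by (auto simp: path_def)
qed

text \<open>
  Removing an edge \<open>y\<close> of the tree path separates \<open>a\<close> from \<open>b\<close>, so some edge of the given
  connection reconnects the tree; by minimality it is at least as expensive as \<open>y\<close>.
\<close>

lemma min_spanning_tree_minimax: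
  assumes mst: "min_spanning_tree S E U T" and graph: "simple_graph S E" "finite S"
    and ab: "a \<in> S" "b \<in> S" "conn {e \<in> E. U e \<le> c} a b"
  shows "path_max T U a b \<le> ereal c"
proof -
  have T: "tree S T" "T \<subseteq> E"
    using mst spanning_tree_imp_tree graph by (auto simp: min_spanning_tree_def spanning_tree_def)
  obtain P where P: "P \<subseteq> T" "conn P a b" "\<And>y. y \<in> P \<Longrightarrow> \<not> conn (T - {y}) a b"
    using tree_circuit[OF T(1) ab(1,2)] by blast
  obtain p where p: "path P a p b" using conn_imp_path[OF P(2)] by blast
  then have "path T a p b" using P(1) by (auto simp: path_def successively_iff_path_edges)
  then have tp: "tree_path T a b = p" by (rule tree_path_eq[OF T(1)])
  have "U y \<le> c" if y: "y \<in> path_edges p" for y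
  proof -
    have yP: "y \<in> P" using y p by (auto simp: path_def successively_iff_path_edges)
    obtain u v where uv: "{u, v} \<in> E" "U {u, v} \<le> c" "\<not> conn (T - {y}) u v"
      using conn_replace[OF ab(3), of "T - {y}"] P(3)[OF yP] by blast
    have "{u, v} \<subseteq> S" using graph(1) uv(1) by (rule simple_graph_subset)
    then have ex: "tree S (insert {u, v} (T - {y}))" "{u, v} \<notin> T - {y}"
      using tree_exchange[OF T(1), of y u v] uv(3) P(1) yP by auto
    have "spanning_tree S E (insert {u, v} (T - {y}))"
      using ex(1) by (rule tree_imp_spanning_tree) (use uv(1) T(2) in auto)
    then have "sum U T \<le> sum U (insert {u, v} (T - {y}))" using mst by (simp add: min_spanning_tree_def)
    then have "U y \<le> U {u, v}"
      using sum_exchange[OF tree_finite[OF T(1)] _ ex(2), of U] P(1) yP by auto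
    then show ?thesis using uv(2) by simp
  qed
  then show ?thesis using tp by (simp add: path_max_le_iff)
qed

section \<open>W-graphs as trees with an added root\<close>

text \<open>
  The tree on \<open>'a option\<close> with root \<open>None\<close> that is made of a forest \<open>F\<close> and root edges to \<open>W\<close>.
  In particular, \<open>rooted E S\<close> is the whole enlarged graph.
\<close>

definition rooted :: "'a set set \<Rightarrow> 'a set \<Rightarrow> 'a option set set" where
  "rooted F W = (`) Some ` F \<union> (\<lambda>w. {None, Some w}) ` W"

definition root_edges :: "'a option set set" where
  "root_edges = {e. None \<in> e}"

definition rooted_weight :: "('a \<Rightarrow> real) \<Rightarrow> ('a set \<Rightarrow> real) \<Rightarrow> 'a option set \<Rightarrow> real" where
  "rooted_weight V U e =
     (if None \<in> e then V (the_elem (Option.these e)) else U (Option.these e))"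

abbreviation optimal_forest ::
    "'a set \<Rightarrow> 'a set set \<Rightarrow> ('a \<Rightarrow> real) \<Rightarrow> ('a set \<Rightarrow> real) \<Rightarrow> nat \<Rightarrow> 'a set set \<Rightarrow> 'a set \<Rightarrow> bool" where
  "optimal_forest S E V U k F W \<equiv>
     optimal_red_tree (insert None (Some ` S)) (rooted E S) root_edges (rooted_weight V U) k (rooted F W)"

lemma rooted_weight_simps [simp]:
  "rooted_weight V U {None, Some w} = V w" "rooted_weight V U (Some ` e) = U e"
  by (auto simp: rooted_weight_def these_insert_Some these_image_Some_eq)

lemma in_root_edges [simp]: "{None, Some w} \<in> root_edges" "Some ` e \<notin> root_edges"
  by (auto simp: root_edges_def)

lemma image_Some_eq_iff [simp]: "Some ` e = Some ` f \<longleftrightarrow> e = f"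
  by (simp add: inj_image_eq_iff)

lemma in_rooted [simp]:
  "Some ` e \<in> rooted F W \<longleftrightarrow> e \<in> F" "{None, Some w} \<in> rooted F W \<longleftrightarrow> w \<in> W"
proof -
  have "Some ` e \<noteq> {None, Some w'}" for w' by (metis image_iff insertI1 option.distinct(1))
  then show "Some ` e \<in> rooted F W \<longleftrightarrow> e \<in> F" by (auto simp: rooted_def image_iff)
  have "{None, Some w} \<noteq> Some ` f" for f by (metis image_iff insertI1 option.distinct(1))
  then show "{None, Some w} \<in> rooted F W \<longleftrightarrow> w \<in> W"
    by (simp add: rooted_def image_iff doubleton_eq_iff)
qed

lemma rooted_edge_iff: "{Some a, y} \<in> rooted F W \<longleftrightarrow> (case y of None \<Rightarrow> a \<in> W | Some b \<Rightarrow> {a, b} \<in> F)"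
proof (cases y)
  case None
  then show ?thesis by (simp add: insert_commute)
next
  case (Some b)
  then have "{Some a, y} = Some ` {a, b}" by simp
  then show ?thesis using Some in_rooted(1)[of "{a, b}" F W] by simp
qed

lemma rooted_cases:
  assumes "e \<in> rooted F W"
  obtains f where "f \<in> F" "e = Some ` f" | w where "w \<in> W" "e = {None, Some w}"
  using assms unfolding rooted_def by blast

lemma rooted_Int_root_edges: "rooted F W \<inter> root_edges = (\<lambda>w. {None, Some w}) ` W"
  by (auto elim!: rooted_cases)

lemma rooted_Diff_root_edges: "rooted F W - root_edges = (`) Some ` F"
  by (auto elim!: rooted_cases)

lemma inj_on_root_edge: "inj_on (\<lambda>w. {None, Some w}) W"
  by (auto simp: inj_on_def doubleton_eq_iff)

lemma inj_on_image_Some: "inj_on ((`) Some) F"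
  by (auto intro: inj_onI)

lemma rooted_eq_iff: "rooted F W = rooted F' W' \<longleftrightarrow> F = F' \<and> W = W'"
proof
  assume eq: "rooted F W = rooted F' W'"
  have "e \<in> F \<longleftrightarrow> e \<in> F'" "w \<in> W \<longleftrightarrow> w \<in> W'" for e w
    using in_rooted[where F = F and W = W] in_rooted[where F = F' and W = W'] eq by blast+
  then show "F = F' \<and> W = W'" by blast
qed simp

lemma rooted_remove: "rooted F W - {{None, Some w}} = rooted F (W - {w})"
proof (rule set_eqI)
  fix e
  have "e \<in> rooted F W - {{None, Some w}} \<longleftrightarrow> e \<in> rooted F (W - {w})"
    if "(\<exists>f. e = Some ` f) \<or> (\<exists>w. e = {None, Some w})"
    using that in_root_edges by (metis Diff_iff doubleton_eq_iff in_rooted option.inject singletonD singletonI)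
  then show "e \<in> rooted F W - {{None, Some w}} \<longleftrightarrow> e \<in> rooted F (W - {w})"
    by (auto elim!: rooted_cases)
qed

lemma rooted_insert: "insert (Some ` e) (rooted F W - {{None, Some w}}) = rooted (insert e F) (W - {w})"
  unfolding rooted_remove by (simp add: rooted_def)

lemma subset_rootedE:
  assumes "Q \<subseteq> rooted F W"
  obtains F' W' where "F' \<subseteq> F" "W' \<subseteq> W" "Q = rooted F' W'"
proof
  show "{e \<in> F. Some ` e \<in> Q} \<subseteq> F" "{w \<in> W. {None, Some w} \<in> Q} \<subseteq> W" by auto
  show "Q = rooted {e \<in> F. Some ` e \<in> Q} {w \<in> W. {None, Some w} \<in> Q}"
  proof
    show "Q \<subseteq> rooted {e \<in> F. Some ` e \<in> Q} {w \<in> W. {None, Some w} \<in> Q}"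
    proof
      fix e assume e: "e \<in> Q"
      then have "e \<in> rooted F W" using assms by blast
      then show "e \<in> rooted {e \<in> F. Some ` e \<in> Q} {w \<in> W. {None, Some w} \<in> Q}"
        by (cases rule: rooted_cases) (use e in simp_all)
    qed
  qed (auto elim!: rooted_cases)
qed

lemma sum_rooted:
  assumes "finite F" "finite W"
  shows "sum c (rooted F W) = (\<Sum>e\<in>F. c (Some ` e)) + (\<Sum>w\<in>W. c {None, Some w})"
proof -
  have "sum c (rooted F W) = sum c ((`) Some ` F) + sum c ((\<lambda>w. {None, Some w}) ` W)"
    unfolding rooted_def using assms by (intro sum.union_disjoint) auto
  then show ?thesis by (simp add: sum.reindex inj_on_root_edge inj_on_image_Some)
qed

lemma card_rooted: "finite F \<Longrightarrow> finite W \<Longrightarrow> card (rooted F W) = card F + card W"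
  using sum_rooted[of F W "\<lambda>_. 1::nat"] by simp

lemma conn_rooted_mono:
  assumes "conn F a b"
  shows "conn (rooted F W) (Some a) (Some b)"
  using assms
proof (induction rule: rtrancl_induct)
  case (step y z)
  then have "conn (rooted F W) (Some y) (Some z)"
    by (intro conn_edge) (simp add: rooted_edge_iff adj_def)
  with step.IH show ?case by (rule rtrancl_trans)
qed simp

text \<open>
  A connection in the enlarged graph stays in the component of \<open>a\<close> as long as it does not pass
  the root, and it can reach the root only from a state of \<open>W\<close>.
\<close>

lemma conn_rooted_cases:
  assumes "conn (rooted F W) (Some a) y"
  shows "(\<exists>w\<in>W. conn F a w) \<or> (\<exists>b. y = Some b \<and> conn F a b)"
  using assms
proof (induction rule: rtrancl_induct)
  case (step y z)
  show ?case
  proof (cases "\<exists>w\<in>W. conn F a w")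
    case False
    then obtain b where b: "y = Some b" "conn F a b" using step.IH by blast
    have "{Some b, z} \<in> rooted F W" using step.hyps(2) b(1) by (simp add: adj_def)
    then obtain c where c: "z = Some c" "{b, c} \<in> F"
      using False b(2) by (auto simp: rooted_edge_iff split: option.splits)
    have "conn F a c" using b(2) conn_edge[OF c(2)] by (rule rtrancl_trans)
    then show ?thesis using c(1) by blast
  qed simp
qed auto

lemma conn_rooted_root: "w \<in> W \<Longrightarrow> conn F a w \<Longrightarrow> conn (rooted F W) (Some a) None"
  using conn_rooted_mono[of a w F W] conn_edge[of "Some w" None "rooted F W"]
  by (auto simp: rooted_edge_iff intro: rtrancl_trans)

lemma W_graph_sinks: "W_graph S E W g \<Longrightarrow> W \<subseteq> S \<Longrightarrow> sinks S g = W"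
  unfolding W_graph_def sinks_def by blast

text \<open>
  Every state reaches a sink along the arrows, so the tree is connected; as no two arrows share
  an edge, it has \<open>|S - W| + |W| = |S|\<close> edges.
\<close>

lemma W_graph_tree:
  assumes "finite S" "simple_graph S E" "W \<subseteq> S" and g: "W_graph S E W g"
  defines "F \<equiv> undirected g"
  shows "red_tree (insert None (Some ` S)) (rooted E S) root_edges (card W) (rooted F W)"
    and "W_cost V U g = sum (rooted_weight V U) (rooted F W) - sum V S"
proof -
  have edges: "\<And>i j. (i, j) \<in> g \<Longrightarrow> {i, j} \<in> E" and out: "\<And>i. i \<in> S - W \<Longrightarrow> \<exists>!j. (i, j) \<in> g"
    and no_out: "\<And>i j. i \<in> W \<Longrightarrow> (i, j) \<notin> g" and acyc: "acyclic g"
    using g by (auto simp: W_graph_def)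
  have g_in: "i \<in> S - W" "j \<in> S" "i \<noteq> j" if "(i, j) \<in> g" for i j
    using edges[OF that] no_out[of i j] that assms(2) simple_graph_subset[of S E "{i, j}"]
    by (auto elim!: simple_graphE)
  have "g \<subseteq> S \<times> S" using g_in by auto
  then have "finite g" using assms(1) by (meson finite_SigmaI finite_subset)
  then have fin: "finite g" "finite W" "finite F"
    using finite_subset[OF assms(3,1)] by (auto simp: F_def undirected_def)
  have inj_fst: "inj_on fst g"
  proof (rule inj_onI)
    fix x y assume "x \<in> g" "y \<in> g" "fst x = fst y"
    then show "x = y" using out[of "fst x"] g_in(1) by (cases x; cases y) auto
  qed
  have fst: "fst ` g = S - W"
  proof
    show "fst ` g \<subseteq> S - W" using g_in(1) by auto
    show "S - W \<subseteq> fst ` g" using out by force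
  qed
  have inj: "inj_on (\<lambda>(i, j). {i, j}) g"
  proof (rule inj_onI, clarify)
    fix i j i' j' assume ij: "(i, j) \<in> g" "(i', j') \<in> g" "{i, j} = {i', j'}"
    have "\<not> (i' = j \<and> j' = i)"
    proof
      assume "i' = j \<and> j' = i"
      then have "(i, i) \<in> g\<^sup>+" using ij(1,2) by (meson trancl.simps)
      then show False using acyc by (simp add: acyclic_def)
    qed
    then show "i = i' \<and> j = j'" using ij(3) by (auto simp: doubleton_eq_iff)
  qed
  have "card F = card (S - W)"
    using card_image[OF inj] card_image[OF inj_fst] fst by (simp add: F_def undirected_def)
  then have card: "card (rooted F W) = card S"
    using card_rooted[OF fin(3,2)] assms(1,3) fin(2) by (simp add: card_Diff_subset card_mono)
  have "conn (rooted F W) (Some i) None" if "i \<in> S" for i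
  proof -
    have "wf (g\<inverse>)" using fin(1) acyc by (rule finite_acyclic_wf_converse)
    then show ?thesis using that
    proof (induction i rule: wf_induct_rule)
      case (less i)
      show ?case
      proof (cases "i \<in> W")
        case True
        then show ?thesis by (intro conn_edge) (simp add: rooted_edge_iff)
      next
        case False
        then obtain j where j: "(i, j) \<in> g" using out less.prems by blast
        then have "conn (rooted F W) (Some j) None" using less.IH g_in(2) by blast
        moreover have "conn (rooted F W) (Some i) (Some j)"
          using j by (intro conn_edge) (auto simp: rooted_edge_iff F_def undirected_def)
        ultimately show ?thesis by (meson rtrancl_trans)
      qed
    qed
  qed
  then have "connected_graph (insert None (Some ` S)) (rooted F W)"
    by (intro connected_graphI_root[of None]) auto
  moreover have FE: "F \<subseteq> E" using edges by (auto simp: F_def undirected_def)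
  then have sub: "rooted F W \<subseteq> rooted E S" using assms(3) by (auto simp: rooted_def)
  moreover have "simple_graph (insert None (Some ` S)) (rooted F W)"
    unfolding simple_graph_def
  proof
    fix e assume "e \<in> rooted F W"
    then show "\<exists>i\<in>insert None (Some ` S). \<exists>j\<in>insert None (Some ` S). i \<noteq> j \<and> e = {i, j}"
    proof (cases rule: rooted_cases)
      case (1 f)
      then obtain a b where ab: "f = {a, b}" "a \<in> S" "b \<in> S" "a \<noteq> b"
        using FE assms(2) simple_graphE[of S E f] by blast
      show ?thesis by (rule bexI[of _ "Some a"], rule bexI[of _ "Some b"]) (use 1 ab in auto)
    next
      case (2 w)
      show ?thesis by (rule bexI[of _ None], rule bexI[of _ "Some w"]) (use 2 assms(3) in auto)
    qed
  qed
  ultimately show "red_tree (insert None (Some ` S)) (rooted E S) root_edges (card W) (rooted F W)"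
    unfolding red_tree_def tree_def using card assms(1)
    by (simp add: rooted_Int_root_edges card_image inj_on_root_edge)
  have "W_cost V U g = (\<Sum>(i, j)\<in>g. U {i, j}) - (\<Sum>x\<in>g. V (fst x))"
    unfolding W_cost_def by (simp add: sum_subtractf[symmetric] case_prod_unfold)
  also have "(\<Sum>(i, j)\<in>g. U {i, j}) = sum U F"
    unfolding F_def undirected_def by (subst sum.reindex[OF inj]) (simp add: case_prod_unfold)
  also have "(\<Sum>x\<in>g. V (fst x)) = sum V (S - W)"
    using sum.reindex[OF inj_fst, of V] fst by simp
  also have "\<dots> = sum V S - sum V W" using assms(1,3) by (rule sum_diff)
  finally show "W_cost V U g = sum (rooted_weight V U) (rooted F W) - sum V S"
    using sum_rooted[OF fin(3,2), of "rooted_weight V U"] by simp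
qed

text \<open>
  The arrows point from each state to its parent, that is, towards the root; the sinks are the
  states whose parent is the root.
\<close>

lemma red_tree_W_graph:
  assumes B: "red_tree (insert None (Some ` S)) (rooted E S) root_edges k B"
  obtains W g where "W \<subseteq> S" "card W = k" "W_graph S E W g" "B = rooted (undirected g) W"
proof -
  let ?X = "insert None (Some ` S)"
  have tree: "tree ?X B" and sub: "B \<subseteq> rooted E S" and k: "card (B \<inter> root_edges) = k"
    using B by (auto simp: red_tree_def)
  obtain par and d :: "'a option \<Rightarrow> nat" where
    par: "\<And>i. i \<in> ?X - {None} \<Longrightarrow> {i, par i} \<in> B \<and> par i \<in> ?X \<and> d (par i) < d i"
    "inj_on (\<lambda>i. {i, par i}) (?X - {None})"
    using connected_graph_parents[of ?X B None] tree unfolding tree_def by blast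
  have X: "?X - {None} = Some ` S" by auto
  have "(\<lambda>i. {i, par i}) ` (?X - {None}) = B"
  proof (rule card_subset_eq)
    show "finite B" using tree by (rule tree_finite)
    show "(\<lambda>i. {i, par i}) ` (?X - {None}) \<subseteq> B" using par(1) by blast
    have "card (?X - {None}) = card B" using tree by (auto simp: tree_def)
    then show "card ((\<lambda>i. {i, par i}) ` (?X - {None})) = card B" using card_image[OF par(2)] by simp
  qed
  then have B_eq: "B = (\<lambda>i. {Some i, par (Some i)}) ` S" unfolding X by (simp add: image_image)
  have par_S: "{Some i, par (Some i)} \<in> B" "d (par (Some i)) < d (Some i)" if "i \<in> S" for i
    using par(1)[of "Some i"] that by auto
  define W where "W = {i \<in> S. par (Some i) = None}"
  define g where "g = {(i, j). i \<in> S \<and> par (Some i) = Some j}"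
  have B_rooted: "B = rooted (undirected g) W"
  proof
    show "B \<subseteq> rooted (undirected g) W"
    proof
      fix e assume "e \<in> B"
      then obtain i where i: "i \<in> S" "e = {Some i, par (Some i)}" using B_eq by blast
      then show "e \<in> rooted (undirected g) W"
        by (cases "par (Some i)") (auto simp: rooted_edge_iff W_def g_def undirected_def)
    qed
    show "rooted (undirected g) W \<subseteq> B"
    proof
      fix e assume "e \<in> rooted (undirected g) W"
      then show "e \<in> B"
      proof (cases rule: rooted_cases)
        case (1 f)
        then obtain i j where "i \<in> S" "par (Some i) = Some j" "f = {i, j}"
          by (auto simp: undirected_def g_def)
        then show ?thesis using 1 par_S(1)[of i] by simp
      next
        case (2 w)
        then show ?thesis using par_S(1)[of w] by (simp add: W_def insert_commute)
      qed
    qed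
  qed
  have "acyclic g"
  proof (rule acyclic_subset)
    show "g \<subseteq> (measure (\<lambda>i. d (Some i)))\<inverse>" using par_S(2) by (force simp: g_def)
    show "acyclic ((measure (\<lambda>i. d (Some i)))\<inverse>)" by (simp add: wf_acyclic)
  qed
  moreover have "{i, j} \<in> E" if "(i, j) \<in> g" for i j
    using par_S(1)[of i] sub that by (auto simp: g_def rooted_edge_iff dest!: subsetD)
  ultimately have "W_graph S E W g" unfolding W_graph_def by (auto simp: W_def g_def)
  moreover have "card W = k"
    using k unfolding B_rooted rooted_Int_root_edges by (simp add: card_image inj_on_root_edge)
  moreover have "W \<subseteq> S" by (auto simp: W_def)
  ultimately show thesis using that B_rooted by blast
qed

lemma optimal_W_graph_imp_optimal_forest:
  assumes "finite S" "simple_graph S E" "optimal_W_graph S E V U k g"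
  shows "optimal_forest S E V U k (undirected g) (sinks S g)"
  unfolding optimal_red_tree_def
proof (intro conjI allI impI)
  obtain W where W: "W \<subseteq> S" "card W = k" "W_graph S E W g"
    using assms(3) by (auto simp: optimal_W_graph_def W_graphs_def)
  then have sinks: "sinks S g = W" using W_graph_sinks by blast
  note g = W_graph_tree[OF assms(1,2) W(1,3), unfolded W(2)]
  show "red_tree (insert None (Some ` S)) (rooted E S) root_edges k (rooted (undirected g) (sinks S g))"
    unfolding sinks by (rule g(1))
  fix B' assume "red_tree (insert None (Some ` S)) (rooted E S) root_edges k B'"
  then obtain W' h where h: "W' \<subseteq> S" "card W' = k" "W_graph S E W' h" "B' = rooted (undirected h) W'"
    by (rule red_tree_W_graph)
  then have "W_cost V U g \<le> W_cost V U h"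
    using assms(3) by (auto simp: optimal_W_graph_def W_graphs_def)
  then show "sum (rooted_weight V U) (rooted (undirected g) (sinks S g)) \<le> sum (rooted_weight V U) B'"
    unfolding sinks h(4) using g(2)[of V U] W_graph_tree(2)[OF assms(1,2) h(1,3), of V U] by simp
qed

lemma generic_imp_generic_colouring:
  assumes "generic S E V U"
  shows "generic_colouring (rooted E S) root_edges (rooted_weight V U)"
  unfolding generic_colouring_def rooted_Int_root_edges rooted_Diff_root_edges
proof (intro conjI)
  have gen: "inj_on V S" "inj_on U E" "inj_on (\<lambda>(e, k). U e - V k) (E \<times> S)"
    using assms by (auto simp: generic_def)
  show "inj_on (rooted_weight V U) ((\<lambda>w. {None, Some w}) ` S)"
    using gen(1) by (auto simp: inj_on_def)
  show "inj_on (rooted_weight V U) ((`) Some ` E)"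
    using gen(2) by (auto simp: inj_on_def)
  show "inj_on (\<lambda>(e, w). rooted_weight V U e - rooted_weight V U w)
      ((`) Some ` E \<times> (\<lambda>w. {None, Some w}) ` S)"
    using gen(3) by (auto simp: inj_on_def)
qed

lemma optimal_forests_nested:
  assumes gen: "generic S E V U"
    and opt: "optimal_forest S E V U (Suc j) F W" "optimal_forest S E V U j F' W'"
    and s: "s \<in> W - W'"
  obtains e where "e \<in> E - F" "F' = insert e F" "W' = W - {s}"
proof -
  have s': "{None, Some s} \<in> rooted F W - rooted F' W'" using s by simp
  obtain x where x: "x \<in> rooted E S - root_edges" "x \<notin> rooted F W"
      "rooted F' W' = insert x (rooted F W - {{None, Some s}})"
    using optimal_red_trees_nested[OF generic_imp_generic_colouring[OF gen] opt s' in_root_edges(1)]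
    by blast
  then obtain e where e: "e \<in> E" "x = Some ` e" unfolding rooted_Diff_root_edges by blast
  have "rooted F' W' = rooted (insert e F) (W - {s})" using x(3) unfolding e(2) rooted_insert .
  then show thesis using that e x(2) by (simp add: rooted_eq_iff)
qed

section \<open>The largest cycle around a sink\<close>

lemma optimal_forestD:
  assumes "optimal_forest S E V U k F W"
  shows "tree (insert None (Some ` S)) (rooted F W)" "F \<subseteq> E" "W \<subseteq> S"
    "red_tree (insert None (Some ` S)) (rooted E S) root_edges k (rooted F W)"
proof -
  show r: "red_tree (insert None (Some ` S)) (rooted E S) root_edges k (rooted F W)"
    using assms by (simp add: optimal_red_tree_def)
  then show "tree (insert None (Some ` S)) (rooted F W)" by (simp add: red_tree_def)
  have sub: "rooted F W \<subseteq> rooted E S" using r by (simp add: red_tree_def)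
  show "F \<subseteq> E"
  proof
    fix e assume "e \<in> F"
    then have "Some ` e \<in> rooted E S" using sub in_rooted(1)[of e F W] by blast
    then show "e \<in> E" by simp
  qed
  show "W \<subseteq> S"
  proof
    fix w assume "w \<in> W"
    then have "{None, Some w} \<in> rooted E S" using sub in_rooted(2)[of w F W] by blast
    then show "w \<in> S" by simp
  qed
qed

text \<open>
  A component of the forest has only one sink, so without the sink \<open>s\<close> it is cut off from the root.
\<close>

lemma sink_separated:
  assumes "tree X (rooted F W)" "s \<in> W"
  shows "\<not> conn (rooted F (W - {s})) (Some s) None"
  using tree_edge_bridge[OF assms(1), of None "Some s"] assms(2)
    conn_sym[of "Some s" None "rooted F (W - {s})"] by (auto simp: rooted_remove)

text \<open>
  Within the component of \<open>s\<close>, the root edge to \<open>s\<close> may be replaced by the one to \<open>x\<close>.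
\<close>

lemma optimal_forest_sink_minimal:
  assumes opt: "optimal_forest S E V U k F W" and s: "s \<in> W" and x: "x \<in> S" "conn F s x"
  shows "V s \<le> V x"
proof -
  note B = optimal_forestD[OF opt]
  have "\<not> conn (rooted F (W - {s})) None (Some x)"
  proof
    assume "conn (rooted F (W - {s})) None (Some x)"
    then have "conn (rooted F (W - {s})) (Some s) None"
      using conn_rooted_mono[OF x(2), of "W - {s}"] by (meson conn_sym rtrancl_trans)
    then show False using sink_separated[OF B(1) s] by blast
  qed
  then have "\<not> conn (rooted F W - {{None, Some s}}) None (Some x)" by (simp add: rooted_remove)
  then have ex: "tree (insert None (Some ` S)) (insert {None, Some x} (rooted F W - {{None, Some s}}))"
      "{None, Some x} \<notin> rooted F W - {{None, Some s}}"
    using tree_exchange[OF B(1), of "{None, Some s}" None "Some x"] s x(1) by auto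
  have "rooted_weight V U {None, Some s} \<le> rooted_weight V U {None, Some x}"
    by (rule optimal_red_tree_exchange[OF opt _ _ ex(2,1)]) (use s x(1) in simp_all)
  then show ?thesis by simp
qed

text \<open>
  Dropping the sink \<open>s\<close> detaches exactly its component. An edge leaving the component attaches
  it again, so it competes with \<open>e\<close>, which is the optimal choice.
\<close>

lemma cheap_edge_stays_in_component:
  assumes graph: "simple_graph S E"
    and opt: "optimal_forest S E V U (Suc j) F W" "optimal_forest S E V U j (insert e F) (W - {s})"
    and s: "s \<in> W" and e: "e \<in> E - F"
    and uv: "{u, v} \<in> E" "conn F s u" "U {u, v} < U e"
  shows "conn F s v"
proof (rule ccontr)
  assume nv: "\<not> conn F s v"
  let ?r = "{None, Some s}"
  note B = optimal_forestD[OF opt(1)]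
  have "\<not> conn (rooted F (W - {s})) (Some u) (Some v)"
  proof
    assume "conn (rooted F (W - {s})) (Some u) (Some v)"
    then have "conn (rooted F (W - {s})) (Some s) (Some v)"
      using conn_rooted_mono[OF uv(2), of "W - {s}"] by (meson rtrancl_trans)
    then obtain w where w: "w \<in> W - {s}" "conn F s w"
      using conn_rooted_cases[of s "Some v" F "W - {s}"] nv by blast
    then show False using conn_rooted_root[OF w] sink_separated[OF B(1) s] by blast
  qed
  moreover have "{u, v} \<subseteq> S" using graph uv(1) by (rule simple_graph_subset)
  ultimately have ex: "tree (insert None (Some ` S)) (insert (Some ` {u, v}) (rooted F W - {?r}))"
      "Some ` {u, v} \<notin> rooted F W - {?r}"
    using tree_exchange[OF B(1), of ?r "Some u" "Some v"] s by (auto simp: rooted_remove)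
  have ins: "Some ` {u, v} \<in> rooted E S" "Some ` e \<in> rooted E S" using uv(1) e by (simp_all only: in_rooted) auto
  have rs: "?r \<in> rooted F W" using s by simp
  have new: "red_tree (insert None (Some ` S)) (rooted E S) root_edges j
        (insert (Some ` {u, v}) (rooted F W - {?r}))"
      "sum (rooted_weight V U) (insert (Some ` {u, v}) (rooted F W - {?r})) =
        sum (rooted_weight V U) (rooted F W) - V s + U {u, v}"
    using red_tree_exchange(1)[OF B(4) rs ins(1) ex(2,1), where j' = j]
      red_tree_exchange(2)[OF B(4) rs ins(1) ex(2,1), where j' = j and c = "rooted_weight V U"]
    by (simp_all del: image_insert)
  have "tree (insert None (Some ` S)) (insert (Some ` e) (rooted F W - {?r}))"
    using optimal_forestD(1)[OF opt(2)] by (simp add: rooted_insert)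
  then have old: "sum (rooted_weight V U) (rooted (insert e F) (W - {s})) =
        sum (rooted_weight V U) (rooted F W) - V s + U e"
    using red_tree_exchange(2)[OF B(4) rs ins(2), where j' = j and c = "rooted_weight V U"] e
    by (simp add: rooted_insert)
  have "sum (rooted_weight V U) (rooted (insert e F) (W - {s})) \<le>
      sum (rooted_weight V U) (insert (Some ` {u, v}) (rooted F W - {?r}))"
    using opt(2) new(1) by (simp add: optimal_red_tree_def del: image_insert)
  then show False using new(2) old uv(3) by simp
qed

text \<open>
  The edge \<open>e\<close> closes a circuit with \<open>rooted F W\<close>, and each edge of the circuit can be exchanged
  for \<open>e\<close>. Optimality of \<open>(F, W)\<close> makes the edges of \<open>F\<close> on the circuit no more expensive than
  \<open>e\<close>; optimality of \<open>(insert e F, W - {s})\<close> makes \<open>s\<close> the highest sink on it. The circuit passes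
  the root through \<open>s\<close> and through another sink, which is \<open>x\<close>.
\<close>

lemma lower_state_within_gap:
  assumes graph: "simple_graph S E" and inj: "inj_on V S"
    and opt: "optimal_forest S E V U (Suc j) F W" "optimal_forest S E V U j (insert e F) (W - {s})"
    and s: "s \<in> W" and e: "e \<in> E - F"
  obtains x where "x \<in> S" "V x < V s" "conn {f \<in> E. U f \<le> U e} s x"
proof -
  let ?r = "{None, Some s}" and ?X = "insert None (Some ` S)" and ?c = "rooted_weight V U"
  let ?A = "{f \<in> E. U f \<le> U e}"
  note B = optimal_forestD[OF opt(1)] and B' = optimal_forestD[OF opt(2)]
  obtain p q where pq: "e = {p, q}" "p \<in> S" "q \<in> S" using graph e by (blast elim: simple_graphE)
  have e_Some: "Some ` e = {Some p, Some q}" using pq(1) by simp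
  have e_new: "Some ` e \<in> rooted E S" "Some ` e \<notin> rooted F W" using e by simp_all
  \<comment> \<open>Without the sink \<open>s\<close>, the edge \<open>e\<close> is a bridge of \<open>rooted (insert e F) (W - {s})\<close>; so the circuit passes \<open>s\<close>.\<close>
  have cut: "\<not> conn (rooted F (W - {s})) (Some p) (Some q)"
  proof -
    have "rooted (insert e F) (W - {s}) - {Some ` e} = rooted F (W - {s})"
      using e by (auto simp: rooted_def)
    then show ?thesis using tree_edge_bridge[OF B'(1), of "Some p" "Some q"] e_Some
      by (metis in_rooted(1) insertI1)
  qed
  obtain P where P: "P \<subseteq> rooted F W" "conn P (Some p) (Some q)"
      "\<And>y. y \<in> P \<Longrightarrow> \<not> conn (rooted F W - {y}) (Some p) (Some q)"
    using tree_circuit[OF B(1), of "Some p" "Some q"] pq by auto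
  have ex: "tree ?X (insert (Some ` e) (rooted F W - {y}))" if "y \<in> P" for y
    using tree_exchange(1)[OF B(1), of y "Some p" "Some q"] P that pq e_Some by auto
  have cheap: "U f \<le> U e" if f: "Some ` f \<in> P" for f
  proof -
    have "?c (Some ` f) \<le> ?c (Some ` e)"
      by (rule optimal_red_tree_exchange[OF opt(1) _ _ _ ex[OF f]]) (use e_new f P(1) in auto)
    then show ?thesis by simp
  qed
  have sums: "sum ?c (rooted (insert e F) (W - {s})) = sum ?c (rooted F W) - V s + U e"
    using sum_exchange[OF tree_finite[OF B(1)], of ?r "Some ` e" ?c] s e_new by (simp add: rooted_insert)
  have low: "V w < V s" if w: "{None, Some w} \<in> P" "w \<noteq> s" for w
  proof -
    have wB: "{None, Some w} \<in> rooted F W" using w P(1) by blast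
    have "red_tree ?X (rooted E S) root_edges j (insert (Some ` e) (rooted F W - {{None, Some w}}))"
      by (rule red_tree_exchange(1)[OF B(4) wB e_new(1) _ ex[OF w(1)]]) (use e_new in simp_all)
    then have "sum ?c (rooted (insert e F) (W - {s})) \<le>
        sum ?c (insert (Some ` e) (rooted F W - {{None, Some w}}))"
      using opt(2) by (simp add: optimal_red_tree_def)
    also have "\<dots> = sum ?c (rooted F W) - V w + U e"
      using sum_exchange[OF tree_finite[OF B(1)] wB, of "Some ` e" ?c] e_new by simp
    finally have "V w \<le> V s" using sums by simp
    moreover have "V w \<noteq> V s" using inj_onD[OF inj, of w s] w(2) wB s B(3) by auto
    ultimately show ?thesis by simp
  qed
  have Pr: "P - {?r} \<subseteq> rooted F (W - {s})" using P(1) by (auto simp: rooted_remove[symmetric])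
  then obtain F1 W1 where FW: "F1 \<subseteq> F" "W1 \<subseteq> W - {s}" "P - {?r} = rooted F1 W1" by (rule subset_rootedE)
  have "\<not> conn (P - {?r}) (Some p) (Some q)" using cut conn_mono[OF _ Pr] by blast
  then have "conn (P - {?r}) (Some p) None \<and> conn (P - {?r}) (Some s) (Some q) \<or>
      conn (P - {?r}) (Some p) (Some s) \<and> conn (P - {?r}) None (Some q)"
    using conn_split_edge[OF P(2), of None "Some s"] by blast
  then obtain a b where ab: "{a, b} = e" "conn (rooted F1 W1) (Some s) (Some a)"
      "conn (rooted F1 W1) (Some b) None"
  proof (elim disjE conjE)
    assume "conn (P - {?r}) (Some p) None" "conn (P - {?r}) (Some s) (Some q)"
    then show thesis using that[of q p] by (simp add: FW(3) pq(1) insert_commute)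
  next
    assume "conn (P - {?r}) (Some p) (Some s)" "conn (P - {?r}) None (Some q)"
    then show thesis using that[of p q] conn_sym[of "Some p"] conn_sym[of None]
      unfolding FW(3) pq(1) by blast
  qed
  have F1: "F1 \<subseteq> ?A"
  proof
    fix f assume f: "f \<in> F1"
    then have "Some ` f \<in> P" using FW(3) in_rooted(1)[of f F1 W1] by blast
    then show "f \<in> ?A" using cheap f FW(1) B(2) by blast
  qed
  obtain w where w: "w \<in> W1" "conn F1 b w" using conn_rooted_cases[OF ab(3)] by blast
  \<comment> \<open>The part of the circuit next to \<open>s\<close> must not return to the root, from which \<open>s\<close> is separated.\<close>
  have "\<not> (\<exists>w'\<in>W1. conn F1 s w')"
    using conn_rooted_root[of _ W1 s F1] conn_mono[OF _ Pr[unfolded FW(3)]] sink_separated[OF B(1) s]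
    by blast
  then have "conn F1 s a" using conn_rooted_cases[OF ab(2)] by blast
  then have "conn ?A s a" using F1 by (rule conn_mono)
  moreover have "conn ?A a b" by (rule conn_edge) (use ab(1) e in auto)
  moreover have "conn ?A b w" using w(2) F1 by (rule conn_mono)
  ultimately have "conn ?A s w" by (meson rtrancl_trans)
  moreover have "{None, Some w} \<in> P" using FW(3) w(1) in_rooted(2)[of w F1 W1] by blast
  then have "V w < V s" using low FW(2) w(1) by blast
  ultimately show thesis using that[of w] FW(2) w(1) B(3) by blast
qed

theorem theorem4:
  fixes S :: "'a set" and E :: "'a set set"
    and V :: "'a \<Rightarrow> real" and U :: "'a set \<Rightarrow> real"
    and T :: "'a set set" and g :: "nat \<Rightarrow> 'a rel"
    and k :: nat and s p q :: 'a
  assumes "finite S"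
    and "simple_graph S E"
    and "connected_graph S E"
    and "generic S E V U"
    and "min_spanning_tree S E U T"
    and "2 \<le> k" and "k \<le> card S"
    and "\<And>j. 1 \<le> j \<Longrightarrow> j \<le> k \<Longrightarrow> optimal_W_graph S E V U j (g j)"
    and "s \<in> sinks S (g k)"
    and "\<And>j. 1 \<le> j \<Longrightarrow> j \<le> k - 1 \<Longrightarrow> s \<notin> sinks S (g j)"
    and "{p, q} \<in> undirected (g (k - 1))"
    and "{p, q} \<notin> undirected (g k)"
  shows "is_largest
           {C. freidlin_cycle S T U s C \<and> (\<nexists>x. x \<in> C \<and> V x < V s)}
           {x \<in> component S (undirected (g k)) s. path_max T U s x < ereal (U {p, q})}"
proof -
  let ?F = "undirected (g k)" and ?W = "sinks S (g k)" and ?e = "{p, q}"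
  obtain j where j: "k = Suc j" "1 \<le> j" using assms(6) by (cases k) auto
  have s: "s \<in> S" using assms(9) by (simp add: sinks_def)
  have opt: "optimal_forest S E V U (Suc j) ?F ?W"
      "optimal_forest S E V U j (undirected (g j)) (sinks S (g j))"
    using optimal_W_graph_imp_optimal_forest[OF assms(1,2) assms(8)] j by auto
  have "s \<in> ?W - sinks S (g j)" using assms(9) assms(10)[of j] j by simp
  then obtain e where e: "e \<in> E - ?F" "undirected (g j) = insert e ?F" "sinks S (g j) = ?W - {s}"
    using optimal_forests_nested[OF assms(4) opt] by blast
  have "e = ?e" using assms(11,12) e(2) j by simp
  note opt' = opt(2)[unfolded e(2,3) \<open>e = ?e\<close>] and e' = e(1)[unfolded \<open>e = ?e\<close>]
  have T: "tree S T" "T \<subseteq> E"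
    using assms(5) spanning_tree_imp_tree[OF _ assms(2,1)]
    by (auto simp: min_spanning_tree_def spanning_tree_def)
  have stays: "conn ?F s x" if x: "x \<in> S" "path_max T U s x < ereal (U ?e)" for x
  proof -
    have "conn {f \<in> T. U f < U ?e} s x" using path_max_lessD[OF T(1) s x] .
    then show ?thesis
    proof (induction rule: rtrancl_induct)
      case (step u v)
      then have "{u, v} \<in> E" "U {u, v} < U ?e" using T(2) by (auto simp: adj_def)
      then show ?case
        using cheap_edge_stays_in_component[OF assms(2) opt(1) opt' assms(9) e'] step.IH by blast
    qed simp
  qed
  obtain y where y: "y \<in> S" "V y < V s" "conn {f \<in> E. U f \<le> U ?e} s y"
    using lower_state_within_gap[OF assms(2) _ opt(1) opt' assms(9) e'] assms(4)
    by (auto simp: generic_def)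
  \<comment> \<open>This state lies in every Freidlin cycle of a level above \<open>U {p, q}\<close>.\<close>
  have y_near: "path_max T U s y \<le> ereal (U ?e)"
    using min_spanning_tree_minimax[OF assms(5,2,1) s y(1,3)] .
  show ?thesis
    unfolding is_largest_def
  proof (intro conjI ballI)
    have "{x \<in> component S ?F s. path_max T U s x < ereal (U ?e)} =
        {x \<in> S. path_max T U s x < ereal (U ?e)}"
      using stays by (auto simp: component_def)
    moreover have "\<not> V x < V s" if "x \<in> component S ?F s" for x
      using optimal_forest_sink_minimal[OF opt(1) assms(9), of x] that by (auto simp: component_def)
    ultimately show "{x \<in> component S ?F s. path_max T U s x < ereal (U ?e)}
        \<in> {C. freidlin_cycle S T U s C \<and> (\<nexists>x. x \<in> C \<and> V x < V s)}"
      unfolding freidlin_cycle_def by blast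
    fix D assume "D \<in> {C. freidlin_cycle S T U s C \<and> (\<nexists>x. x \<in> C \<and> V x < V s)}"
    then obtain a where a: "D = {x \<in> S. path_max T U s x < ereal a}" "\<And>x. x \<in> D \<Longrightarrow> \<not> V x < V s"
      by (auto simp: freidlin_cycle_def)
    have "y \<notin> D" using a(2) y(2) by blast
    then have "ereal a \<le> path_max T U s y" using a(1) y(1) by auto
    then have "ereal a \<le> ereal (U ?e)" using y_near by (rule order_trans)
    then have "D \<subseteq> {x \<in> S. path_max T U s x < ereal (U ?e)}"
      unfolding a(1) by (auto simp del: ereal_less_eq intro: less_le_trans)
    then show "D \<subseteq> {x \<in> component S ?F s. path_max T U s x < ereal (U ?e)}"
      using stays by (auto simp: component_def)
  qed
qed

end
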